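(* Let $f:\mathbb{R}^d\to\mathbb{R}$ be convex and twice continuously differentiable, bounded from below, with bounded level-sets, and suppose $\nabla^2 f$ is $L_2$-Lipschitz, i.e. $\|\nabla^2 f(\mathbf{x})-\nabla^2 f(\mathbf{y})\|\le L_2\|\mathbf{x}-\mathbf{y}\|$ for all $\mathbf{x},\mathbf{y}\in\mathbb{R}^d$. Let $m\ge 1$ be an integer, $M>0$ with $M\ge L_2$, $\mathbf{x}_0\in\mathbb{R}^d$, and let $\{\mathbf{x}_k\}_{k\ge 0}$ be the sequence generated from $\mathbf{x}_0$ by the Krylov cubic regularized Newton method with subspace dimension $m$ and regularization parameter $M$. Let $\mathbf{x}^*$ be a minimizer of $f$ and let $D=\sup\{\|\mathbf{x}-\mathbf{x}^*\| : \mathbf{x}\in\mathbb{R}^d,\ f(\mathbf{x})\le f(\mathbf{x}_0)\}$. Then for every integer $k\ge 1$, $$f(\mathbf{x}_k)-f(\mathbf{x}^* )\le \frac{9\rho^{(m)}_{\max}D^2}{2m}\left(\frac1k+\frac1{k^2}\right)+\frac{9(L_2+M)D^3}{2k^2},$$ where $\rho^{(m)}_{\max}=\max_{i\in\{0,1,\dots,k-1\}}\rho^{(m)}(\nabla^2 f(\mathbf{x}_i),\nabla f(\mathbf{x}_i))$.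
   Context: Vector norms are Euclidean and matrix norms are operator norms. For a symmetric matrix $\mathbf{A}\in\mathbb{R}^{d\times d}$ and $\mathbf{b}\in\mathbb{R}^d$, the $j$-th Krylov subspace is $\mathcal{K}_j(\mathbf{A},\mathbf{b})=\mathrm{span}\{\mathbf{b},\mathbf{A}\mathbf{b},\dots,\mathbf{A}^{j-1}\mathbf{b}\}$. Krylov cubic regularized Newton method: with $\mathbf{g}_k=\nabla f(\mathbf{x}_k)$ and $\mathbf{H}_k=\nabla^2 f(\mathbf{x}_k)$, $$\mathbf{s}_k=\operatorname*{arg\,min}_{\mathbf{s}\in\mathcal{K}_m(\mathbf{H}_k,\mathbf{g}_k)}\Big\{\mathbf{g}_k^\top\mathbf{s}+\tfrac12\mathbf{s}^\top\mathbf{H}_k\mathbf{s}+\tfrac M6\|\mathbf{s}\|^3\Big\},\qquad \mathbf{x}_{k+1}=\mathbf{x}_k+\mathbf{s}_k .$$ (This is equivalent to minimizing over coordinates with respect to an orthonormal basis of the Krylov subspace.) For $j\ge1$ define $$\sigma^{(j)}(\mathbf{A},\mathbf{b})=\max_{\mathbf{w}\in\mathcal{K}_j(\mathbf{A},\mathbf{b}),\ \|\mathbf{w}\|=1}\mathrm{dist}\big(\mathbf{A}\mathbf{w},\mathcal{K}_j(\mathbf{A},\mathbf{b})\big),\qquad \mathrm{dist}(\mathbf{u},\mathcal{V})=\min_{\mathbf{v}\in\mathcal{V}}\|\mathbf{u}-\mathbf{v}\|,$$ and $\rho^{(m)}(\mathbf{A},\mathbf{b})=\big(\prod_{j=1}^m\sigma^{(j)}(\mathbf{A},\mathbf{b})\big)^{1/m}$.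 Convention: if $\mathbf{b}=0$ (so the Krylov subspace is $\{0\}$) then $\sigma^{(j)}(\mathbf{A},\mathbf{b})=0$. *)

theory Defs
  imports "HOL-Analysis.Analysis"
begin

definition gradient :: "('a::euclidean_space \<Rightarrow> real) \<Rightarrow> 'a \<Rightarrow> 'a" where
  "gradient f x = (THE g. GDERIV f x :> g)"

lemma gradient_eqI:
  assumes "GDERIV f x :> g"
  shows "gradient f x = g"
  unfolding gradient_def
proof (rule the_equality)
  fix g' assume "GDERIV f x :> g'"
  then have "(\<lambda>h. inner h g') = (\<lambda>h. inner h g)"
    using assms has_derivative_unique unfolding gderiv_def by blast
  then have "inner h (g' - g) = 0" for h
    by (metis inner_diff_right right_minus_eq)
  then show "g' = g"
    using inner_eq_zero_iff right_minus_eq by blast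
qed (fact assms)

definition hessian :: "(real^'n \<Rightarrow> real) \<Rightarrow> real^'n \<Rightarrow> real^'n^'n" where
  "hessian f x = matrix (frechet_derivative (gradient f) (at x))"

definition twice_continuously_differentiable :: "(real^'n \<Rightarrow> real) \<Rightarrow> bool" where
  "twice_continuously_differentiable f \<longleftrightarrow>
     (\<forall>x. f differentiable (at x)) \<and>
     (\<forall>x. gradient f differentiable (at x)) \<and>
     continuous_on UNIV (hessian f)"

lemma twice_continuously_differentiableD:
  assumes "twice_continuously_differentiable f"
  shows "GDERIV f x :> gradient f x"
    and "(gradient f has_derivative (\<lambda>h. hessian f x *v h)) (at x)"
proof -
  obtain f' where f': "(f has_derivative f') (at x)"
    using assms unfolding twice_continuously_differentiable_def differentiable_def by blast
  interpret f': linear f' using f' has_derivative_linear by blast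
  have "f' = (\<lambda>h. inner h (adjoint f' 1))"
    by (rule ext) (use adjoint_works[OF f'.linear_axioms, of _ 1] in simp)
  then have "GDERIV f x :> adjoint f' 1"
    using f' unfolding gderiv_def by simp
  then show "GDERIV f x :> gradient f x"
    using gradient_eqI by metis
  have "(gradient f has_derivative frechet_derivative (gradient f) (at x)) (at x)"
    using assms frechet_derivative_works
    unfolding twice_continuously_differentiable_def by blast
  then show "(gradient f has_derivative (\<lambda>h. hessian f x *v h)) (at x)"
    unfolding hessian_def by (simp add: has_derivative_linear matrix_works eta_contract_eq)
qed

definition krylov :: "nat \<Rightarrow> real^'n^'n \<Rightarrow> real^'n \<Rightarrow> (real^'n) set" where
  "krylov j A b = span {((\<lambda>v. A *v v) ^^ i) b | i. i < j}"

definition krylov_sigma :: "nat \<Rightarrow> real^'n^'n \<Rightarrow> real^'n \<Rightarrow> real" where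
  "krylov_sigma j A b =
     (if b = 0 then 0
      else (SUP w\<in>{w \<in> krylov j A b. norm w = 1}. infdist (A *v w) (krylov j A b)))"

text \<open>The infimum in \<open>infdist\<close> and the supremum in \<^const>\<open>krylov_sigma\<close> are a genuine minimum
  and maximum.\<close>

lemma infdist_krylov_attained:
  "\<exists>v\<in>krylov j A b. infdist u (krylov j A b) = norm (u - v)"
proof -
  have "closed (krylov j A b)" "krylov j A b \<noteq> {}"
    unfolding krylov_def using span_zero by (auto simp: closed_span)
  then show ?thesis
    by (metis infdist_attains_inf dist_norm)
qed

lemma krylov_sigma_attained:
  assumes "b \<noteq> 0" and "j \<ge> 1"
  shows "\<exists>w\<in>krylov j A b. norm w = 1 \<and> krylov_sigma j A b = infdist (A *v w) (krylov j A b) \<and>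
           (\<forall>w'\<in>krylov j A b. norm w' = 1 \<longrightarrow>
              infdist (A *v w') (krylov j A b) \<le> krylov_sigma j A b)"
proof -
  let ?K = "krylov j A b" and ?S = "{w \<in> krylov j A b. norm w = 1}"
  let ?h = "\<lambda>w. infdist (A *v w) (krylov j A b)"
  have "b \<in> ?K"
    unfolding krylov_def using assms(2)
    by (intro span_base) (auto intro!: exI[of _ 0])
  then have "b /\<^sub>R norm b \<in> ?K"
    unfolding krylov_def by (rule span_scale)
  then have "?S \<noteq> {}"
    using assms(1) by (auto intro!: exI[of _ "b /\<^sub>R norm b"])
  moreover have "?S = ?K \<inter> sphere 0 1"
    by auto
  then have "compact ?S"
    unfolding krylov_def by (simp add: closed_Int_compact closed_span)
  moreover have "continuous_on ?S ?h"
    by (intro continuous_intros linear_continuous_on matrix_vector_mul_bounded_linear)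
  ultimately obtain w where w: "w \<in> ?S" "\<forall>w'\<in>?S. ?h w' \<le> ?h w"
    using continuous_attains_sup by meson
  then have "(SUP w\<in>?S. ?h w) = ?h w"
    by (intro cSup_eq_maximum) auto
  then show ?thesis
    using w assms(1) unfolding krylov_sigma_def by auto
qed

definition krylov_rho :: "nat \<Rightarrow> real^'n^'n \<Rightarrow> real^'n \<Rightarrow> real" where
  "krylov_rho m A b = root m (\<Prod>j=1..m. krylov_sigma j A b)"

definition cubic_model :: "real \<Rightarrow> real^'n \<Rightarrow> real^'n^'n \<Rightarrow> real^'n \<Rightarrow> real" where
  "cubic_model M g H s = inner g s + 1/2 * inner s (H *v s) + M/6 * norm s ^ 3"

definition krylov_cubic_newton ::
    "nat \<Rightarrow> real \<Rightarrow> (real^'n \<Rightarrow> real) \<Rightarrow> real^'n \<Rightarrow> (nat \<Rightarrow> real^'n) \<Rightarrow> bool" where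
  "krylov_cubic_newton m M f x0 x \<longleftrightarrow>
     x 0 = x0 \<and>
     (\<forall>k. \<exists>s. is_arg_min (cubic_model M (gradient f (x k)) (hessian f (x k)))
                (\<lambda>s. s \<in> krylov m (hessian f (x k)) (gradient f (x k))) s \<and>
              x (Suc k) = x k + s)"

end

theory Submission
  imports Defs
begin

text \<open>Split a vector \<open>s\<close> along the flag of Krylov subspaces: let \<open>P\<^sub>j\<close> be the orthogonal projection
  onto the \<open>j\<close>-th one and \<open>d\<^sub>j = P\<^sub>j s - P\<^sub>j\<^sub>-\<^sub>1 s\<close>. As \<open>A\<close> is positive semidefinite and
  maps each subspace into the next, replacing
  \<open>s\<close> by \<open>P\<^sub>j s\<close> raises the quadratic model by at most \<open>\<sigma>\<^sub>j \<parallel>d\<^sub>j\<parallel> \<parallel>d\<^sub>j\<^sub>+\<^sub>1\<parallel>\<close>. The sum of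
  \<open>\<parallel>d\<^sub>j\<parallel> \<parallel>d\<^sub>j\<^sub>+\<^sub>1\<parallel>\<close> over \<open>j = 1, \<dots>, m\<close> is at most \<open>\<parallel>s\<parallel>\<^sup>2\<close>, so by the inequality of arithmetic and
  geometric means some \<open>j\<close> costs at most \<open>(\<rho>/m) \<parallel>s\<parallel>\<^sup>2\<close>. Hence a step of the method is as good as any
  full-space step \<open>s\<close> up to \<open>(\<rho>/m) \<parallel>s\<parallel>\<^sup>2\<close> plus the cubic error, and the rate follows from testing with
  \<open>s = \<alpha> (x\<^sup>* - x\<^sub>k)\<close> as for the ordinary cubic Newton method.\<close>

section \<open>Limits and remainder bounds in one real variable\<close>

text \<open>Let t tend to 0 from the right. Taylor estimates for a step scaled by t take this form
  once divided by a power of t.\<close>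

lemma le_of_le_add_mult:
  fixes a b c :: real
  assumes "\<And>t. 0 < t \<Longrightarrow> t \<le> 1 \<Longrightarrow> a \<le> b + c * t"
  shows "a \<le> b"
proof (rule tendsto_lowerbound)
  show "((\<lambda>t. b + c * t) \<longlongrightarrow> b) (at_right 0)"
    by (auto intro!: tendsto_eq_intros)
  show "\<forall>\<^sub>F t in at_right 0. a \<le> b + c * t"
    using assms unfolding eventually_at_right_field by (intro exI[of _ 1]) auto
qed simp

text \<open>Adding u or -u to the antiderivative of \<open>c * t ^ n\<close> gives a nondecreasing
  function on [0, 1]. This yields Taylor remainders without integrals.\<close>

lemma abs_diff_le_of_deriv_le_power:
  fixes u u' :: "real \<Rightarrow> real"
  assumes deriv: "\<And>t. 0 \<le> t \<Longrightarrow> t \<le> 1 \<Longrightarrow> DERIV u t :> u' t"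
    and bound: "\<And>t. 0 \<le> t \<Longrightarrow> t \<le> 1 \<Longrightarrow> \<bar>u' t\<bar> \<le> c * t ^ n"
  shows "\<bar>u 1 - u 0\<bar> \<le> c / real (Suc n)"
proof -
  let ?p = "\<lambda>t. c * t ^ Suc n / real (Suc n)"
  have p: "DERIV ?p t :> c * t ^ n" for t
    by (auto intro!: derivative_eq_intros simp del: power_Suc)
  have "?p 0 + u 0 \<le> ?p 1 + u 1"
    by (rule DERIV_nonneg_imp_nondecreasing[where f = "\<lambda>t. ?p t + u t"])
      (use DERIV_add[OF p deriv] bound in \<open>fastforce simp: abs_le_iff\<close>)+
  moreover have "?p 0 - u 0 \<le> ?p 1 - u 1"
    by (rule DERIV_nonneg_imp_nondecreasing[where f = "\<lambda>t. ?p t - u t"])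
      (use DERIV_diff[OF p deriv] bound in \<open>fastforce simp: abs_le_iff\<close>)+
  ultimately show ?thesis
    by auto
qed

section \<open>Functions with Lipschitz Hessian\<close>

locale lipschitz_hessian =
  fixes f :: "real^'n \<Rightarrow> real" and L :: real
  assumes twice_diff: "twice_continuously_differentiable f"
    and lipschitz: "\<And>y z. onorm (\<lambda>v. (hessian f y - hessian f z) *v v) \<le> L * norm (y - z)"
begin

lemma L_nonneg: "0 \<le> L"
proof -
  \<comment> \<open>Any unit vector serves: the Lipschitz bound between \<open>e\<close> and 0 has
    right-hand side \<open>L\<close>.\<close>
  define e :: "real^'n" where "e = axis undefined 1"
  have "0 \<le> onorm (\<lambda>v. (hessian f e - hessian f 0) *v v)"
    by (rule onorm_pos_le) (rule matrix_vector_mul_bounded_linear)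
  also have "\<dots> \<le> L * norm (e - 0)"
    by (rule lipschitz)
  finally show ?thesis
    by (simp add: e_def norm_axis_1)
qed

lemma norm_hessian_diff_le:
  "norm (hessian f y *v v - hessian f z *v v) \<le> L * norm (y - z) * norm v"
proof -
  have "norm ((hessian f y - hessian f z) *v v)
      \<le> onorm (\<lambda>v. (hessian f y - hessian f z) *v v) * norm v"
    by (rule onorm) (rule matrix_vector_mul_bounded_linear)
  also have "\<dots> \<le> L * norm (y - z) * norm v"
    by (intro mult_right_mono lipschitz norm_ge_zero)
  finally show ?thesis
    by (simp add: matrix_vector_mult_diff_rdistrib)
qed

lemma DERIV_line: "DERIV (\<lambda>t. f (x + t *\<^sub>R h)) t :> gradient f (x + t *\<^sub>R h) \<bullet> h"
proof -
  have f': "(f has_derivative (\<lambda>s. s \<bullet> gradient f (x + t *\<^sub>R h))) (at (x + t *\<^sub>R h))"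
    using twice_continuously_differentiableD(1)[OF twice_diff] by (simp add: gderiv_def)
  have "((\<lambda>t. f (x + t *\<^sub>R h)) has_derivative (\<lambda>s. (s *\<^sub>R h) \<bullet> gradient f (x + t *\<^sub>R h))) (at t)"
    by (rule has_derivative_compose[where f = "\<lambda>t. x + t *\<^sub>R h", OF _ f'])
      (auto intro!: derivative_eq_intros)
  then show ?thesis
    unfolding has_field_derivative_def
    by (rule has_derivative_eq_rhs) (simp add: fun_eq_iff inner_commute)
qed

lemma DERIV_gradient_line:
  "DERIV (\<lambda>t. gradient f (x + t *\<^sub>R h) \<bullet> v) t :> (hessian f (x + t *\<^sub>R h) *v h) \<bullet> v"
proof -
  have "((\<lambda>t. gradient f (x + t *\<^sub>R h)) has_derivative
      (\<lambda>s. hessian f (x + t *\<^sub>R h) *v (s *\<^sub>R h))) (at t)"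
    by (rule has_derivative_compose[where f = "\<lambda>t. x + t *\<^sub>R h",
          OF _ twice_continuously_differentiableD(2)[OF twice_diff]])
      (auto intro!: derivative_eq_intros)
  from has_derivative_inner_left[OF this, of v] show ?thesis
    unfolding has_field_derivative_def
    by (rule has_derivative_eq_rhs) (simp add: fun_eq_iff matrix_vector_mult_scaleR)
qed

text \<open>Pairing with a fixed \<open>v\<close> makes the remainder a scalar function of t, whose
  derivative the Lipschitz condition bounds linearly in t.\<close>

lemma gradient_taylor:
  "\<bar>(gradient f (x + h) - gradient f x - hessian f x *v h) \<bullet> v\<bar> \<le> L / 2 * norm h ^ 2 * norm v"
proof -
  let ?u = "\<lambda>t. gradient f (x + t *\<^sub>R h) \<bullet> v - t * ((hessian f x *v h) \<bullet> v)"
  have "\<bar>?u 1 - ?u 0\<bar> \<le> (L * norm h ^ 2 * norm v) / real (Suc 1)"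
  proof (rule abs_diff_le_of_deriv_le_power)
    fix t :: real assume t: "0 \<le> t" "t \<le> 1"
    show "DERIV ?u t :> (hessian f (x + t *\<^sub>R h) *v h) \<bullet> v - (hessian f x *v h) \<bullet> v"
      by (rule DERIV_diff[OF DERIV_gradient_line]) (auto intro!: derivative_eq_intros)
    have "\<bar>(hessian f (x + t *\<^sub>R h) *v h - hessian f x *v h) \<bullet> v\<bar>
        \<le> norm (hessian f (x + t *\<^sub>R h) *v h - hessian f x *v h) * norm v"
      by (rule Cauchy_Schwarz_ineq2)
    also have "\<dots> \<le> L * norm (x + t *\<^sub>R h - x) * norm h * norm v"
      by (intro mult_right_mono norm_hessian_diff_le norm_ge_zero)
    finally show "\<bar>(hessian f (x + t *\<^sub>R h) *v h) \<bullet> v - (hessian f x *v h) \<bullet> v\<bar>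
        \<le> L * norm h ^ 2 * norm v * t ^ 1"
      using t by (simp add: inner_diff_left power2_eq_square mult_ac)
  qed
  then show ?thesis
    by (simp add: inner_diff_left algebra_simps)
qed

text \<open>Along the segment, the derivative of the remainder is the gradient remainder for the
  step \<open>t *\<^sub>R h\<close> paired with \<open>h\<close>, which is quadratic in t.\<close>

lemma taylor:
  "\<bar>f (x + h) - f x - gradient f x \<bullet> h - 1/2 * (h \<bullet> (hessian f x *v h))\<bar> \<le> L / 6 * norm h ^ 3"
proof -
  let ?q = "h \<bullet> (hessian f x *v h)"
  let ?u = "\<lambda>t. f (x + t *\<^sub>R h) - t * (gradient f x \<bullet> h) - t ^ 2 / 2 * ?q"
  have "\<bar>?u 1 - ?u 0\<bar> \<le> (L / 2 * norm h ^ 3) / real (Suc 2)"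
  proof (rule abs_diff_le_of_deriv_le_power)
    fix t :: real assume t: "0 \<le> t" "t \<le> 1"
    show "DERIV ?u t :> gradient f (x + t *\<^sub>R h) \<bullet> h - gradient f x \<bullet> h - t * ?q"
      by (intro DERIV_diff DERIV_line) (auto intro!: derivative_eq_intros)
    show "\<bar>gradient f (x + t *\<^sub>R h) \<bullet> h - gradient f x \<bullet> h - t * ?q\<bar> \<le> L / 2 * norm h ^ 3 * t ^ 2"
      using gradient_taylor[of x "t *\<^sub>R h" h] t
      by (simp add: inner_diff_left inner_diff_right matrix_vector_mult_scaleR inner_commute
          power_mult_distrib power2_eq_square power3_eq_cube mult_ac)
  qed
  then show ?thesis
    by (simp add: algebra_simps)
qed

lemma taylor_scaled:
  assumes "0 \<le> t"
  shows "\<bar>f (x + t *\<^sub>R h) - f x - t * (gradient f x \<bullet> h) - t\<^sup>2 / 2 * (h \<bullet> (hessian f x *v h))\<bar>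
    \<le> t ^ 3 * (L / 6 * norm h ^ 3)"
  using taylor[of x "t *\<^sub>R h"] assms
  by (simp add: matrix_vector_mult_scaleR power_mult_distrib power2_eq_square mult_ac)

text \<open>The second difference \<open>f (x + u + v) - f (x + u) - f (x + v) + f x\<close> is symmetric in
  \<open>u\<close> and \<open>v\<close>, and both \<open>H u \<bullet> v\<close> and \<open>H v \<bullet> u\<close> agree with it to third order.\<close>

lemma hessian_symmetric: "(hessian f x *v u) \<bullet> v = u \<bullet> (hessian f x *v v)"
proof -
  define S where "S u v = f (x + u + v) - f (x + u) - f (x + v) + f x" for u v
  define C where
    "C u v = L / 2 * norm u ^ 2 * norm v + L / 2 * norm u * norm v ^ 2 + L / 3 * norm v ^ 3"
    for u v :: "real^'n"
  have S: "\<bar>S u v - (hessian f x *v u) \<bullet> v\<bar> \<le> C u v" for u v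
  proof -
    \<comment> \<open>The expansions about \<open>x + u\<close> and about \<open>x\<close> differ by
      a gradient difference paired with \<open>v\<close>, half of this Hessian difference and two
      cubic remainders; their errors are the three terms of \<open>C\<close>.\<close>
    have "\<bar>v \<bullet> (hessian f (x + u) *v v - hessian f x *v v)\<bar>
        \<le> norm v * norm (hessian f (x + u) *v v - hessian f x *v v)"
      by (rule Cauchy_Schwarz_ineq2)
    also have "\<dots> \<le> norm v * (L * norm (x + u - x) * norm v)"
      by (intro mult_left_mono norm_hessian_diff_le norm_ge_zero)
    finally have "\<bar>v \<bullet> (hessian f (x + u) *v v) - v \<bullet> (hessian f x *v v)\<bar> \<le> L * norm u * norm v ^ 2"
      by (simp add: inner_diff_right power2_eq_square mult_ac)
    then show ?thesis
      using taylor[of "x + u" v] taylor[of x v] gradient_taylor[of x u v]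
      unfolding S_def C_def inner_diff_left by linarith
  qed
  \<comment> \<open>\<open>C\<close> has degree 3 and the Hessian form degree 2, so scaling both
    vectors by t and dividing by \<open>t ^ 2\<close> leaves an error of order t.\<close>
  have C: "C (t *\<^sub>R u) (t *\<^sub>R v) = t ^ 3 * C u v" if "0 < t" for t u v
    using that unfolding C_def
    by (simp add: power_mult_distrib power2_eq_square power3_eq_cube algebra_simps)
  have le: "(hessian f x *v u) \<bullet> v \<le> u \<bullet> (hessian f x *v v)" for u v
  proof (rule le_of_le_add_mult)
    fix t :: real assume t: "0 < t" "t \<le> 1"
    have "S (t *\<^sub>R u) (t *\<^sub>R v) = S (t *\<^sub>R v) (t *\<^sub>R u)"
      unfolding S_def by (simp add: add_ac)
    then have "t ^ 2 * ((hessian f x *v u) \<bullet> v)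
        \<le> t ^ 2 * (u \<bullet> (hessian f x *v v)) + t ^ 3 * C u v + t ^ 3 * C v u"
      using S[of "t *\<^sub>R u" "t *\<^sub>R v"] S[of "t *\<^sub>R v" "t *\<^sub>R u"] t
      by (simp add: C matrix_vector_mult_scaleR inner_commute power2_eq_square mult_ac)
    also have "\<dots> = t ^ 2 * (u \<bullet> (hessian f x *v v) + (C u v + C v u) * t)"
      by (simp add: power2_eq_square power3_eq_cube algebra_simps)
    finally show "(hessian f x *v u) \<bullet> v \<le> u \<bullet> (hessian f x *v v) + (C u v + C v u) * t"
      using t by (simp add: mult_le_cancel_left)
  qed
  show ?thesis
    using le[of u v] le[of v u] by (simp add: inner_commute)
qed

text \<open>Convexity bounds the increment over \<open>t *\<^sub>R h\<close> by t times the full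
  increment. Compare with the second-order expansion, divide by t and let t tend to 0.\<close>

lemma gradient_inner_le:
  assumes "convex_on UNIV f"
  shows "gradient f x \<bullet> h \<le> f (x + h) - f x"
proof (rule le_of_le_add_mult)
  fix t :: real assume t: "0 < t" "t \<le> 1"
  let ?q = "h \<bullet> (hessian f x *v h)" and ?n = "L / 6 * norm h ^ 3"
  have "f ((1 - t) *\<^sub>R x + t *\<^sub>R (x + h)) \<le> (1 - t) * f x + t * f (x + h)"
    using convex_onD[OF assms, of t x "x + h"] t by simp
  moreover have "(1 - t) *\<^sub>R x + t *\<^sub>R (x + h) = x + t *\<^sub>R h"
    by (simp add: algebra_simps)
  ultimately have "f (x + t *\<^sub>R h) - f x \<le> t * (f (x + h) - f x)"
    by (simp add: algebra_simps)
  then have "t * (gradient f x \<bullet> h) \<le> t * (f (x + h) - f x) - t\<^sup>2 / 2 * ?q + t ^ 3 * ?n"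
    using abs_le_D2[OF taylor_scaled[of t x h]] t by linarith
  also have "\<dots> = t * (f (x + h) - f x - t / 2 * ?q + t\<^sup>2 * ?n)"
    by (simp add: power2_eq_square power3_eq_cube algebra_simps)
  finally have "gradient f x \<bullet> h \<le> f (x + h) - f x - t / 2 * ?q + t\<^sup>2 * ?n"
    using t by (simp only: mult_le_cancel_left_pos)
  also have "t\<^sup>2 * ?n \<le> t * ?n"
    using t L_nonneg by (intro mult_right_mono) (auto simp: power2_eq_square mult_left_le)
  finally show "gradient f x \<bullet> h \<le> f (x + h) - f x + (?n - ?q / 2) * t"
    by (simp add: algebra_simps)
qed

text \<open>The first-order inequality cancels the linear term of the expansion; dividing the rest
  by \<open>t\<^sup>2 / 2\<close> isolates the quadratic form as t tends to 0.\<close>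

lemma hessian_nonneg:
  assumes "convex_on UNIV f"
  shows "0 \<le> h \<bullet> (hessian f x *v h)"
proof -
  let ?q = "h \<bullet> (hessian f x *v h)"
  have "- ?q \<le> 0"
  proof (rule le_of_le_add_mult)
    fix t :: real assume t: "0 < t" "t \<le> 1"
    have "t * (gradient f x \<bullet> h) \<le> f (x + t *\<^sub>R h) - f x"
      using gradient_inner_le[OF assms, of x "t *\<^sub>R h"] by simp
    then have "0 \<le> t\<^sup>2 / 2 * ?q + t ^ 3 * (L / 6 * norm h ^ 3)"
      using abs_le_D1[OF taylor_scaled[of t x h]] t by linarith
    also have "\<dots> = t\<^sup>2 / 2 * (?q + L / 3 * norm h ^ 3 * t)"
      by (simp add: power2_eq_square power3_eq_cube algebra_simps)
    finally have "0 \<le> ?q + L / 3 * norm h ^ 3 * t"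
      using t by (simp add: zero_le_mult_iff)
    then show "- ?q \<le> 0 + L / 3 * norm h ^ 3 * t"
      by linarith
  qed
  then show ?thesis
    by simp
qed

end

section \<open>Projections onto Krylov subspaces\<close>

lemma subspace_krylov: "subspace (krylov j A b)"
  unfolding krylov_def by simp

lemma krylov_0: "krylov 0 A b = {0}"
  unfolding krylov_def by simp

lemma krylov_zero_right: "krylov j A 0 = {0}"
proof -
  have "((\<lambda>v. A *v v) ^^ i) 0 = 0" for i
    by (induction i) auto
  then have "krylov j A 0 \<subseteq> span {0}"
    unfolding krylov_def by (intro span_mono) auto
  then show ?thesis
    using subspace_0[OF subspace_span] by (auto simp: krylov_def)
qed

lemma krylov_mono: "i \<le> j \<Longrightarrow> krylov i A b \<subseteq> krylov j A b"
  unfolding krylov_def by (intro span_mono) fastforce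

lemma krylov_base: "1 \<le> j \<Longrightarrow> b \<in> krylov j A b"
  unfolding krylov_def by (intro span_base) (auto intro!: exI[of _ 0])

lemma krylov_step:
  assumes "v \<in> krylov j A b"
  shows "A *v v \<in> krylov (Suc j) A b"
proof -
  let ?S = "{((\<lambda>v. A *v v) ^^ i) b | i. i < j}"
  have "A *v v \<in> (\<lambda>v. A *v v) ` span ?S"
    using assms unfolding krylov_def by blast
  moreover have "(\<lambda>v. A *v v) ` span ?S = span ((\<lambda>v. A *v v) ` ?S)"
    by (rule linear_span_image[symmetric]) (rule matrix_vector_mul_linear)
  moreover have "(\<lambda>v. A *v v) ` ?S \<subseteq> {((\<lambda>v. A *v v) ^^ i) b | i. i < Suc j}"
  proof clarify
    fix i assume "i < j"
    then show "\<exists>k. A *v ((\<lambda>v. A *v v) ^^ i) b = ((\<lambda>v. A *v v) ^^ k) b \<and> k < Suc j"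
      by (intro exI[of _ "Suc i"]) simp
  qed
  then have "span ((\<lambda>v. A *v v) ` ?S) \<subseteq> krylov (Suc j) A b"
    unfolding krylov_def by (rule span_mono)
  ultimately show ?thesis
    by blast
qed

lemma krylov_sigma_nonneg: "j \<ge> 1 \<Longrightarrow> 0 \<le> krylov_sigma j A b"
  using krylov_sigma_attained[of b j A] by (cases "b = 0") (auto simp: krylov_sigma_def infdist_nonneg)

lemma krylov_rho_nonneg: "0 \<le> krylov_rho m A b"
  unfolding krylov_rho_def
  by (cases "m = 0") (auto intro!: real_root_ge_zero prod_nonneg krylov_sigma_nonneg)

text \<open>Since \<open>z\<close> is orthogonal to the subspace, the point of it nearest to
  \<open>A *v w\<close> can be subtracted before applying Cauchy-Schwarz, with \<open>w\<close>
  rescaled to norm 1.\<close>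

lemma krylov_sigma_bound:
  assumes "j \<ge> 1" and w: "w \<in> krylov j A b" and z: "\<And>v. v \<in> krylov j A b \<Longrightarrow> z \<bullet> v = 0"
  shows "\<bar>z \<bullet> (A *v w)\<bar> \<le> krylov_sigma j A b * norm z * norm w"
proof (cases "w = 0")
  case False
  \<comment> \<open>This excludes the convention for a zero vector, so that
    \<open>krylov_sigma\<close> is an attained maximum.\<close>
  then have "b \<noteq> 0"
    using w krylov_zero_right[of j A] by auto
  let ?w = "w /\<^sub>R norm w"
  have w': "?w \<in> krylov j A b" "norm ?w = 1"
    using w False by (auto intro: subspace_scale[OF subspace_krylov])
  obtain v where v: "v \<in> krylov j A b" "infdist (A *v ?w) (krylov j A b) = norm (A *v ?w - v)"
    using infdist_krylov_attained by metis
  have "norm (A *v ?w - v) \<le> krylov_sigma j A b"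
    using krylov_sigma_attained[OF \<open>b \<noteq> 0\<close> \<open>j \<ge> 1\<close>, of A] w' v by metis
  moreover have "\<bar>z \<bullet> (A *v ?w - v)\<bar> \<le> norm z * norm (A *v ?w - v)"
    by (rule Cauchy_Schwarz_ineq2)
  ultimately have "\<bar>z \<bullet> (A *v ?w)\<bar> \<le> norm z * krylov_sigma j A b"
    using z[OF v(1)] mult_left_mono[OF _ norm_ge_zero[of z]] by (fastforce simp: inner_diff_right)
  then show ?thesis
    using False by (simp add: matrix_vector_mult_scaleR field_simps)
qed simp

text \<open>Comparing products instead of weighting with \<open>1 / \<sigma>\<^sub>j\<close> covers the case that some \<open>\<sigma>\<^sub>j\<close>
  vanishes.\<close>

lemma exists_mult_le_geometric_mean:
  fixes \<sigma> t :: "nat \<Rightarrow> real"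
  assumes m: "m \<ge> 1"
    and \<sigma>: "\<And>j. j \<in> {1..m} \<Longrightarrow> 0 \<le> \<sigma> j" and t: "\<And>j. j \<in> {1..m} \<Longrightarrow> 0 \<le> t j"
    and sum: "(\<Sum>j=1..m. t j) \<le> R"
  shows "\<exists>j\<in>{1..m}. \<sigma> j * t j \<le> root m (\<Prod>j=1..m. \<sigma> j) * (R / m)"
proof (rule ccontr)
  let ?r = "root m (\<Prod>j=1..m. \<sigma> j)"
  assume "\<not> ?thesis"
  then have less: "?r * (R / m) < \<sigma> j * t j" if "j \<in> {1..m}" for j
    using that by force
  have r: "0 \<le> ?r"
    using m \<sigma> by (intro real_root_ge_zero prod_nonneg) auto
  have R: "0 \<le> R"
    using sum_nonneg[of "{1..m}" t] t sum by force
  have rR: "0 \<le> ?r * (R / m)"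
    using r R by simp
  \<comment> \<open>The mean inequality for the \<open>t j\<close> alone bounds their product by
    \<open>(R / m) ^ m\<close>; multiplying by the product of the \<open>\<sigma> j\<close> then
    contradicts \<open>less\<close>.\<close>
  have "(\<Prod>j=1..m. t j) powr (1 / m) \<le> (\<Sum>j=1..m. t j / m)"
    using arith_geom_mean[of "{1..m}" t] t m by simp
  also have "\<dots> \<le> R / m"
    using sum by (simp add: divide_right_mono flip: sum_divide_distrib)
  finally have "((\<Prod>j=1..m. t j) powr (1 / m)) ^ m \<le> (R / m) ^ m"
    by (intro power_mono) auto
  moreover have "((\<Prod>j=1..m. t j) powr (1 / m)) ^ m = (\<Prod>j=1..m. t j)"
  proof (cases "(\<Prod>j=1..m. t j) = 0")
    case False
    then show ?thesis
      using m t powr_power[OF False, of "1 / m" m] prod_nonneg[of "{1..m}" t] by simp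
  next
    case True
    show ?thesis
      unfolding True using m by simp
  qed
  ultimately have "(\<Prod>j=1..m. t j) \<le> (R / m) ^ m"
    by simp
  then have "(\<Prod>j=1..m. \<sigma> j * t j) \<le> (\<Prod>j=1..m. \<sigma> j) * (R / m) ^ m"
    unfolding prod.distrib using \<sigma> by (intro mult_left_mono prod_nonneg) auto
  also have "\<dots> = (?r * (R / m)) ^ m"
    unfolding power_mult_distrib using m \<sigma> by (subst real_root_pow_pos2) (auto intro: prod_nonneg)
  also have "\<dots> = (\<Prod>j=1..m. ?r * (R / m))"
    by simp
  also have "\<dots> < (\<Prod>j=1..m. \<sigma> j * t j)"
    by (rule prod_mono_strict[of 1]) (use less rR m in \<open>auto intro: less_imp_le le_less_trans\<close>)
  finally show False
    by simp
qed

lemma krylov_projection_exists: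
  "\<exists>p\<in>krylov j A b. \<forall>v\<in>krylov j A b. (s - p) \<bullet> v = 0"
proof -
  obtain y z where "y \<in> span (krylov j A b)"
    and "\<And>w. w \<in> span (krylov j A b) \<Longrightarrow> orthogonal z w" and "s = y + z"
    using orthogonal_subspace_decomp_exists[of "krylov j A b" s] by metis
  then show ?thesis
    using span_eq_iff[THEN iffD2, OF subspace_krylov[of j A b]]
    by (intro bexI[of _ y]) (auto simp: orthogonal_def)
qed

text \<open>The bound on \<open>norm p\<close> ensures that passing from \<open>s\<close> to
  \<open>p\<close> does not increase the cubic regularization term either.\<close>

lemma krylov_quadratic_comparison:
  fixes A :: "real^'n^'n"
  assumes m: "m \<ge> 1"
    and sym: "\<And>u v. (A *v u) \<bullet> v = u \<bullet> (A *v v)"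
    and psd: "\<And>u. 0 \<le> u \<bullet> (A *v u)"
  shows "\<exists>p\<in>krylov m A b. norm p \<le> norm s \<and>
    b \<bullet> p + 1/2 * (p \<bullet> (A *v p))
      \<le> b \<bullet> s + 1/2 * (s \<bullet> (A *v s)) + krylov_rho m A b / m * norm s ^ 2"
proof -
  let ?K = "\<lambda>j. krylov j A b"
  obtain P where P: "\<And>j. P j \<in> ?K j" and orth: "\<And>j v. v \<in> ?K j \<Longrightarrow> (s - P j) \<bullet> v = 0"
    using krylov_projection_exists[of _ A b s] by metis
  define d where "d j = P j - P (j - 1)" for j
  have P0: "P 0 = 0"
    using P[of 0] by (simp add: krylov_0)
  have d_mem: "d j \<in> ?K j" for j
    unfolding d_def using P[of j] P[of "j - 1"] krylov_mono[of "j - 1" j A b]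
    by (auto intro!: subspace_diff[OF subspace_krylov])
  \<comment> \<open>\<open>d (Suc j)\<close> is the difference of the residuals
    \<open>s - P j\<close> and \<open>s - P (Suc j)\<close>, both orthogonal to
    \<open>?K j\<close>.\<close>
  have d_orth: "d (Suc j) \<bullet> v = 0" if "v \<in> ?K j" for j v
  proof -
    have "v \<in> ?K (Suc j)"
      using that krylov_mono[of j "Suc j" A b] by auto
    then show ?thesis
      using orth[of v "Suc j"] orth[of v j] that by (simp add: d_def inner_diff_left)
  qed
  have norm_P: "norm (P n) ^ 2 = (\<Sum>j=1..n. norm (d j) ^ 2)" for n
  proof (induction n)
    case (Suc n)
    have "P (Suc n) = P n + d (Suc n)"
      by (simp add: d_def)
    then have "norm (P (Suc n)) ^ 2 = norm (P n) ^ 2 + norm (d (Suc n)) ^ 2"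
      using d_orth[OF P[of n]]
      by (simp add: power2_norm_eq_inner inner_add_left inner_add_right inner_commute)
    then show ?case
      using Suc by simp
  qed (simp add: P0)
  have P_le: "norm (P n) ^ 2 \<le> norm s ^ 2" for n
  proof -
    have "norm s ^ 2 = norm (P n) ^ 2 + norm (s - P n) ^ 2"
      using orth[OF P[of n]]
      by (simp add: power2_norm_eq_inner inner_diff_left inner_diff_right inner_commute)
    then show ?thesis
      by simp
  qed
  \<comment> \<open>After splitting each product by
    \<open>2 * a * b \<le> a\<^sup>2 + b\<^sup>2\<close>, the shifted squares run up to index
    \<open>Suc m\<close>, so both halves are at most squared norms of projections of
    \<open>s\<close>.\<close>
  have "(\<Sum>j=1..m. norm (d (Suc j)) * norm (d j))
      \<le> (\<Sum>j=1..m. (norm (d (Suc j)) ^ 2 + norm (d j) ^ 2) / 2)"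
    by (intro sum_mono) (use sum_squares_bound[of "norm (d _)" "norm (d (Suc _))"] in \<open>simp add: field_simps\<close>)
  also have "\<dots> = ((\<Sum>j=1..m. norm (d (Suc j)) ^ 2) + norm (P m) ^ 2) / 2"
    by (simp add: norm_P sum.distrib flip: sum_divide_distrib)
  also have "(\<Sum>j=1..m. norm (d (Suc j)) ^ 2) \<le> norm (P (Suc m)) ^ 2"
    unfolding norm_P sum.shift_bounds_cl_Suc_ivl[of "\<lambda>j. norm (d j) ^ 2", symmetric]
    by (intro sum_mono2) auto
  also have "(norm (P (Suc m)) ^ 2 + norm (P m) ^ 2) / 2 \<le> (norm s ^ 2 + norm s ^ 2) / 2"
    by (intro divide_right_mono add_mono P_le) auto
  finally have sum: "(\<Sum>j=1..m. norm (d (Suc j)) * norm (d j)) \<le> norm s ^ 2"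
    by simp
  obtain j where j: "j \<in> {1..m}"
    and small: "krylov_sigma j A b * (norm (d (Suc j)) * norm (d j))
      \<le> krylov_rho m A b * (norm s ^ 2 / m)"
    using exists_mult_le_geometric_mean[OF m _ _ sum, of "\<lambda>j. krylov_sigma j A b"]
    unfolding krylov_rho_def by (auto simp: krylov_sigma_nonneg)
  define p q where "p = P j" and "q = s - P j"
  have s: "s = p + q"
    by (simp add: p_def q_def)
  have Pj: "P j = P (j - 1) + d j"
    by (simp add: d_def)
  \<comment> \<open>As j \<ge> 1, \<open>A\<close> maps \<open>P (j - 1)\<close> into
    \<open>?K j\<close>, which is orthogonal to \<open>q\<close>, so only \<open>d j\<close> counts
    in \<open>p\<close>. As \<open>A *v d j\<close> lies in \<open>?K (Suc j)\<close>, only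
    \<open>d (Suc j)\<close> counts in \<open>q\<close>.\<close>
  have "q \<bullet> (A *v P (j - 1)) = 0"
    using orth[of "A *v P (j - 1)" j] krylov_step[OF P[of "j - 1"]] j by (simp add: q_def)
  then have "q \<bullet> (A *v p) = q \<bullet> (A *v d j)"
    unfolding p_def by (subst Pj) (simp add: matrix_vector_right_distrib inner_add_right)
  also have "\<dots> = d (Suc j) \<bullet> (A *v d j)"
    using orth[OF krylov_step[OF d_mem[of j]]] by (simp add: q_def d_def inner_diff_left)
  finally have "\<bar>q \<bullet> (A *v p)\<bar> \<le> krylov_sigma j A b * norm (d (Suc j)) * norm (d j)"
    using krylov_sigma_bound[OF _ d_mem[of j] d_orth] j by simp
  then have cross: "- (q \<bullet> (A *v p)) \<le> krylov_rho m A b / m * norm s ^ 2"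
    using small by (simp add: mult_ac abs_le_iff)
  \<comment> \<open>Half of this identity shows that passing from \<open>s\<close> to
    \<open>p\<close> drops a nonnegative term in \<open>q\<close> and changes the model otherwise
    only by the cross term.\<close>
  have "s \<bullet> (A *v s) = p \<bullet> (A *v p) + q \<bullet> (A *v q) + 2 * (q \<bullet> (A *v p))"
    unfolding s using sym[of p q]
    by (simp add: matrix_vector_right_distrib inner_add_left inner_add_right inner_commute)
  moreover have "b \<bullet> s = b \<bullet> p"
    unfolding s using orth[OF krylov_base[of j b A]] j by (simp add: q_def inner_add_right inner_commute)
  moreover have "p \<in> ?K m"
    using P[of j] krylov_mono[of j m A b] j by (auto simp: p_def)
  moreover have "norm p \<le> norm s"
    using P_le[of j] by (simp add: p_def abs_le_square_iff[symmetric])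
  ultimately show ?thesis
    using psd[of q] cross by (intro bexI[of _ p] conjI) (assumption | linarith)+
qed

section \<open>Convergence of the method\<close>

context lipschitz_hessian
begin

lemma le_cubic_model:
  assumes "L \<le> M"
  shows "f (x + s) \<le> f x + cubic_model M (gradient f x) (hessian f x) s"
proof -
  have "L / 6 * norm s ^ 3 \<le> M / 6 * norm s ^ 3"
    using assms by (intro mult_right_mono) auto
  then show ?thesis
    using abs_le_D1[OF taylor[of x s]] unfolding cubic_model_def by linarith
qed

text \<open>The model majorizes f at the minimizer \<open>p\<close>, and its value there is at most
  that at the comparison point \<open>q\<close>. The cubic error is M/6 from the regularization at
  \<open>q\<close> and L/6 from returning to f at \<open>x + s\<close>.\<close>

lemma krylov_step_decrease:
  assumes convex: "convex_on UNIV f" and m: "m \<ge> 1" and M: "L \<le> M"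
    and min: "is_arg_min (cubic_model M (gradient f x) (hessian f x))
      (\<lambda>s. s \<in> krylov m (hessian f x) (gradient f x)) p"
  shows "f (x + p) \<le> f (x + s) + krylov_rho m (hessian f x) (gradient f x) / m * norm s ^ 2
    + (L + M) / 6 * norm s ^ 3"
proof -
  let ?g = "gradient f x" and ?H = "hessian f x"
  obtain q where q: "q \<in> krylov m ?H ?g" "norm q \<le> norm s"
    and le: "?g \<bullet> q + 1/2 * (q \<bullet> (?H *v q))
      \<le> ?g \<bullet> s + 1/2 * (s \<bullet> (?H *v s)) + krylov_rho m ?H ?g / m * norm s ^ 2"
    using krylov_quadratic_comparison[OF m hessian_symmetric hessian_nonneg[OF convex]] by blast
  have "0 \<le> M"
    using L_nonneg M by simp
  then have "M / 6 * norm q ^ 3 \<le> M / 6 * norm s ^ 3"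
    using q by (intro mult_left_mono power_mono) auto
  moreover have "cubic_model M ?g ?H p \<le> cubic_model M ?g ?H q"
    using min q by (simp add: is_arg_min_linorder)
  moreover have "(L + M) / 6 * norm s ^ 3 = L / 6 * norm s ^ 3 + M / 6 * norm s ^ 3"
    by (simp add: algebra_simps)
  ultimately show ?thesis
    using le le_cubic_model[OF M, of x p] abs_le_D2[OF taylor[of x s]]
    unfolding cubic_model_def[of M ?g ?H q] by linarith
qed

end

text \<open>The choice \<open>\<alpha> = 1 - (i / (i + 1))\<^sup>3 \<le> 3 / (i + 1)\<close> makes \<open>i\<^sup>3 \<delta>\<^sub>i\<close> telescope.\<close>

lemma cubic_recursion_rate:
  fixes \<delta> :: "nat \<Rightarrow> real"
  assumes step: "\<And>i \<alpha>. i < k \<Longrightarrow> 0 \<le> \<alpha> \<Longrightarrow> \<alpha> \<le> 1 \<Longrightarrow>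
      \<delta> (Suc i) \<le> (1 - \<alpha>) * \<delta> i + A * \<alpha>\<^sup>2 + B * \<alpha> ^ 3"
    and A: "0 \<le> A" and B: "0 \<le> B" and k: "1 \<le> k"
  shows "\<delta> k \<le> 9 * A / 2 * (1 / k + 1 / (real k)\<^sup>2) + 27 * B / (real k)\<^sup>2"
proof -
  \<comment> \<open>Step i contributes \<open>9 * A * (i + 1) + 27 * B\<close>, and the right-hand
    side sums these. Both sides vanish at i = 0, which starts the induction.\<close>
  have "real i ^ 3 * \<delta> i \<le> 9 * A / 2 * (i * (i + 1)) + 27 * B * i" if "i \<le> k" for i
    using that
  proof (induction i)
    case (Suc i)
    define c where "c = real i + 1"
    define \<alpha> where "\<alpha> = 1 - (i / c) ^ 3"
    have c: "0 < c" and ic: "real i = c - 1"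
      by (auto simp: c_def)
    have \<alpha>: "0 \<le> \<alpha>" "\<alpha> \<le> 1"
      unfolding \<alpha>_def c_def by (auto intro!: power_le_one)
    \<comment> \<open>Bernoulli's inequality, applicable since c \<ge> 1, gives
      \<open>c * \<alpha> \<le> 3\<close>.\<close>
    have "1 + 3 * (-1 / c) \<le> (1 + (-1 / c)) ^ 3"
      using Bernoulli_inequality[of "-1 / c" 3] c by (simp add: c_def field_simps)
    moreover have "1 + (-1 / c) = i / c"
      using c by (simp add: ic field_simps)
    ultimately have c\<alpha>: "c * \<alpha> \<le> 3"
      using c unfolding \<alpha>_def by (simp add: field_simps)
    have 1: "c ^ 3 * (1 - \<alpha>) = real i ^ 3"
      using c by (simp add: \<alpha>_def power_divide)
    have "A * (c * (c * \<alpha>)\<^sup>2) \<le> A * (c * 3\<^sup>2)"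
      using c\<alpha> c \<alpha> A by (intro mult_left_mono power_mono) auto
    then have 2: "c ^ 3 * (A * \<alpha>\<^sup>2) \<le> 9 * A * c"
      by (simp add: power2_eq_square power3_eq_cube mult_ac)
    have "B * (c * \<alpha>) ^ 3 \<le> B * 3 ^ 3"
      using c\<alpha> c \<alpha> B by (intro mult_left_mono power_mono) auto
    then have 3: "c ^ 3 * (B * \<alpha> ^ 3) \<le> 27 * B"
      by (simp add: power_mult_distrib mult_ac)
    have "c ^ 3 * \<delta> (Suc i) \<le> c ^ 3 * ((1 - \<alpha>) * \<delta> i + A * \<alpha>\<^sup>2 + B * \<alpha> ^ 3)"
      using step[of i \<alpha>] \<alpha> c Suc.prems by (intro mult_left_mono) auto
    also have "\<dots> = c ^ 3 * (1 - \<alpha>) * \<delta> i + c ^ 3 * (A * \<alpha>\<^sup>2) + c ^ 3 * (B * \<alpha> ^ 3)"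
      by (simp add: algebra_simps)
    also have "\<dots> \<le> (9 * A / 2 * (i * (i + 1)) + 27 * B * i) + 9 * A * c + 27 * B"
      unfolding 1 using 2 3 Suc by simp
    also have "\<dots> = 9 * A / 2 * (Suc i * (Suc i + 1)) + 27 * B * Suc i"
      by (simp add: c_def field_simps)
    finally show ?case
      by (simp add: c_def add.commute)
  qed simp
  then have "real k ^ 3 * \<delta> k \<le> 9 * A / 2 * (k * (k + 1)) + 27 * B * k"
    by simp
  also have "\<dots> = real k ^ 3 * (9 * A / 2 * (1 / k + 1 / (real k)\<^sup>2) + 27 * B / (real k)\<^sup>2)"
    using k by (simp add: field_simps power2_eq_square power3_eq_cube)
  finally show ?thesis
    using k by (simp add: mult_le_cancel_left_pos)
qed

theorem theorem4p4:
  fixes f :: "real^'n \<Rightarrow> real"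
    and L2 M D :: real
    and m k :: nat
    and x0 xstar :: "real^'n"
    and x :: "nat \<Rightarrow> real^'n"
  assumes "convex_on UNIV f"
    and "twice_continuously_differentiable f"
    and "bdd_below (range f)"
    and "\<And>c. bounded {y. f y \<le> c}"
    and "\<And>y z. onorm (\<lambda>v. (hessian f y - hessian f z) *v v) \<le> L2 * norm (y - z)"
    and "m \<ge> 1"
    and "M > 0"
    and "M \<ge> L2"
    and "krylov_cubic_newton m M f x0 x"
    and "\<And>y. f xstar \<le> f y"
    and "D = (SUP y\<in>{y. f y \<le> f x0}. norm (y - xstar))"
    and "k \<ge> 1"
  shows "f (x k) - f xstar \<le>
           9 * (MAX i\<in>{0..k-1}. krylov_rho m (hessian f (x i)) (gradient f (x i))) * D^2 / (2 * real m)
             * (1 / real k + 1 / (real k)^2)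
           + 9 * (L2 + M) * D^3 / (2 * (real k)^2)"
proof -
  interpret lipschitz_hessian f L2
    using assms(2,5) by unfold_locales
  let ?\<rho> = "\<lambda>i. krylov_rho m (hessian f (x i)) (gradient f (x i))"
  \<comment> \<open>As k \<ge> 1, the range \<open>{0..k-1}\<close> is nonempty and consists of the
    indices i < k.\<close>
  define R where "R = (MAX i\<in>{0..k-1}. ?\<rho> i)"
  have \<rho>_le: "?\<rho> i \<le> R" if "i < k" for i
    unfolding R_def using that by (intro Max_ge) auto
  have R: "0 \<le> R"
    using \<rho>_le[of 0] krylov_rho_nonneg[of m "hessian f (x 0)" "gradient f (x 0)"] assms(12) by simp
  have x0: "x 0 = x0"
    using assms(9) by (simp add: krylov_cubic_newton_def)
  have "\<exists>p. is_arg_min (cubic_model M (gradient f (x i)) (hessian f (x i)))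
      (\<lambda>s. s \<in> krylov m (hessian f (x i)) (gradient f (x i))) p \<and> x (Suc i) = x i + p" for i
    using assms(9) by (simp add: krylov_cubic_newton_def)
  then have step: "f (x (Suc i)) \<le> f (x i + s) + ?\<rho> i / m * norm s ^ 2 + (L2 + M) / 6 * norm s ^ 3"
    for i s
    using krylov_step_decrease[OF assms(1,6,8)] by metis
  \<comment> \<open>Comparing with the zero step shows that the iterates stay in the initial level
    set.\<close>
  have level: "f (x i) \<le> f x0" for i
  proof (induction i)
    case (Suc i)
    then show ?case
      using step[of i 0] by simp
  qed (simp add: x0)
  \<comment> \<open>Boundedness of the level set makes the supremum \<open>D\<close> a genuine upper
    bound.\<close>
  obtain c where c: "\<And>y. f y \<le> f x0 \<Longrightarrow> norm y \<le> c"
    using assms(4)[of "f x0"] by (auto simp: bounded_iff)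
  have "bdd_above ((\<lambda>y. norm (y - xstar)) ` {y. f y \<le> f x0})"
    using c by (intro bdd_aboveI2[of _ _ "c + norm xstar"])
      (auto intro: order_trans[OF norm_triangle_ineq4])
  then have D: "norm (x i - xstar) \<le> D" for i
    unfolding assms(11) using level[of i] by (intro cSUP_upper) auto
  have D0: "0 \<le> D"
    using order_trans[OF norm_ge_zero D] .
  have rec: "f (x (Suc i)) - f xstar \<le> (1 - \<alpha>) * (f (x i) - f xstar) + R * D\<^sup>2 / m * \<alpha>\<^sup>2
      + (L2 + M) / 6 * D ^ 3 * \<alpha> ^ 3"
    if i: "i < k" and \<alpha>: "0 \<le> \<alpha>" "\<alpha> \<le> 1" for i \<alpha>
  proof -
    \<comment> \<open>Moving a fraction \<alpha> towards the minimizer contracts the gap by 1 -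
      \<alpha> through convexity, at a step length of at most \<open>\<alpha> * D\<close>.\<close>
    define s where "s = \<alpha> *\<^sub>R (xstar - x i)"
    have s: "norm s \<le> \<alpha> * D"
      using \<alpha> D[of i] by (simp add: s_def norm_minus_commute mult_left_mono)
    have "x i + s = (1 - \<alpha>) *\<^sub>R x i + \<alpha> *\<^sub>R xstar"
      by (simp add: s_def algebra_simps)
    then have "f (x i + s) \<le> (1 - \<alpha>) * f (x i) + \<alpha> * f xstar"
      using convex_onD[OF assms(1), of \<alpha> "x i" xstar] \<alpha> by simp
    moreover have "?\<rho> i / m * norm s ^ 2 \<le> R / m * (\<alpha> * D) ^ 2"
      using s R \<rho>_le[OF i] by (intro mult_mono power_mono divide_right_mono) auto
    moreover have "(L2 + M) / 6 * norm s ^ 3 \<le> (L2 + M) / 6 * (\<alpha> * D) ^ 3"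
      using s L_nonneg assms(7) by (intro mult_left_mono power_mono) auto
    moreover have "(1 - \<alpha>) * (f (x i) - f xstar) = (1 - \<alpha>) * f (x i) + \<alpha> * f xstar - f xstar"
      and "R / m * (\<alpha> * D) ^ 2 = R * D\<^sup>2 / m * \<alpha>\<^sup>2"
      and "(L2 + M) / 6 * (\<alpha> * D) ^ 3 = (L2 + M) / 6 * D ^ 3 * \<alpha> ^ 3"
      by (simp_all add: power_mult_distrib algebra_simps)
    ultimately show ?thesis
      using step[of i s] by linarith
  qed
  \<comment> \<open>Here \<open>A\<close> is \<open>R * D\<^sup>2 / m\<close> and \<open>B\<close>
    is \<open>(L2 + M) / 6 * D ^ 3\<close>, so the last constant is 27/6 = 9/2.\<close>
  have "f (x k) - f xstar \<le> 9 * (R * D\<^sup>2 / m) / 2 * (1 / k + 1 / (real k)\<^sup>2)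
      + 27 * ((L2 + M) / 6 * D ^ 3) / (real k)\<^sup>2"
    by (rule cubic_recursion_rate[where \<delta> = "\<lambda>i. f (x i) - f xstar", OF rec]) (use R D0 L_nonneg assms(7,12) in auto)
  also have "\<dots> = 9 * R * D\<^sup>2 / (2 * real m) * (1 / real k + 1 / (real k)\<^sup>2)
      + 9 * (L2 + M) * D ^ 3 / (2 * (real k)\<^sup>2)"
    using assms(12) by (simp add: field_simps)
  finally show ?thesis
    unfolding R_def .
qed

end
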